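(* Let $(s(n))_{n\ge1}$ be the Stern sequence, defined by $s(1)=1$, $s(2n)=s(n)$, $s(2n+1)=s(n)+s(n+1)$. For $k\in\mathbb{N}_{>0}$ and $N\in\mathbb{N}_{>0}$ put $M_k(N)=\sum_{2^N<n\le 2^{N+1}}s(n)^k$, and let $\sigma_k>0$ be the constant such that $M_k(N)\sim D_k\sigma_k^N$ as $N\to\infty$ for some constant $D_k>0$. Let $\phi=\frac{1+\sqrt5}{2}$, $\delta_2=\frac{2}{\sqrt5}=0.8944\ldots$ and $\eta=0.837$. Then, as $k\to\infty$, $$\sigma_k=\phi^k\big(1+\delta_2^k+O(\eta^k)\big),$$ i.e. there is an absolute constant $C$ with $|\sigma_k/\phi^k-1-\delta_2^k|\le C\eta^k$ for all $k\ge1$.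
   Context: The existence, for each positive integer $k$, of constants $D_k,\sigma_k>0$ with $M_k(N)\sim D_k\sigma_k^N$ is proved in the paper (equivalently $\sigma_k=\lim_{N\to\infty}M_k(N)^{1/N}$). *)

theory Defs
  imports Complex_Main "HOL-Library.Landau_Symbols"
begin

text \<open>The sequence is indexed from 1; the value at 0 is a convention that is never used.\<close>

function stern :: "nat \<Rightarrow> nat" where
  "stern n =
     (if n \<le> 1 then n
      else if even n then stern (n div 2)
      else stern (n div 2) + stern (n div 2 + 1))"
  by pat_completeness auto
termination
  by (relation "measure id") (auto elim!: oddE)

declare stern.simps [simp del]

lemma stern_1: "stern 1 = 1"
  by (simp add: stern.simps)

lemma stern_even: "n \<ge> 1 \<Longrightarrow> stern (2 * n) = stern n"
  by (subst stern.simps) auto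

lemma stern_odd: "n \<ge> 1 \<Longrightarrow> stern (2 * n + 1) = stern n + stern (n + 1)"
  by (subst stern.simps) auto

definition stern_moment :: "nat \<Rightarrow> nat \<Rightarrow> nat" where
  "stern_moment k N = (\<Sum>n\<in>{2 ^ N <.. 2 ^ (N + 1)}. stern n ^ k)"

definition golden :: real where
  "golden = (1 + sqrt 5) / 2"

definition delta2 :: real where
  "delta2 = 2 / sqrt 5"

definition eta :: real where
  "eta = 0.837"

end

theory Submission
  imports Defs
begin

text \<open>
  In the coordinates \<open>x = \<bar>s(n) - s(n + 1)\<bar>\<close>, \<open>y = min (s(n)) (s(n + 1))\<close> the two children of a
  consecutive pair are \<open>B(x, y) = (y, x + y)\<close> and \<open>C(x, y) = (x + y, y)\<close>. Hence a positive
  \<open>k\<close>-homogeneous function \<open>f\<close> with \<open>f(B p) + f(C p) \<le> \<lambda> f(p)\<close> on the quadrant yields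
  \<open>\<sigma>\<^sub>k \<le> \<lambda>\<close>, and the reverse inequality yields \<open>\<sigma>\<^sub>k \<ge> \<lambda>\<close>.

  The linear form \<open>P = x + \<phi> y\<close> satisfies \<open>P(B p) = \<phi> P(p)\<close>, and a single \<open>C\<close> between long runs
  of \<open>B\<close> costs the factor \<open>\<delta>\<^sub>2\<close>. Adding to \<open>P ^ k\<close> the contributions of the words with one \<open>C\<close> and
  fewer than \<open>k\<close> letters \<open>B\<close> gives the lower bound. Two or more letters \<open>C\<close> between
  long runs of \<open>B\<close> cost a factor below \<open>0.836\<close>, the worst case being \<open>C B C\<close>; adding the \<open>k\<close>-th power of a
  piecewise linear function that controls them gives the upper bound.
\<close>

section \<open>Numerical bounds for the golden ratio\<close>

lemma golden_sq: "golden * golden = golden + 1"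
  by (simp add: golden_def field_simps)

lemma golden_bounds: "1.618 \<le> golden" "golden \<le> 1.6181"
proof -
  have "2.236 \<le> sqrt 5" by (rule real_le_rsqrt) (simp add: power2_eq_square)
  moreover have "sqrt 5 \<le> 2.2362" by (rule real_le_lsqrt) (simp_all add: power2_eq_square)
  ultimately show "1.618 \<le> golden" "golden \<le> 1.6181" by (simp_all add: golden_def)
qed

lemma golden_pos: "0 < golden" "golden \<noteq> 0"
  using golden_bounds by auto

lemma golden_mult_bounds:
  assumes "0 \<le> (x::real)"
  shows "1.618 * x \<le> golden * x" "golden * x \<le> 1.6181 * x"
  using mult_right_mono[OF golden_bounds(1) assms] mult_right_mono[OF golden_bounds(2) assms]
  by simp_all

section \<open>Sums over one level of the tree of consecutive Stern pairs\<close>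

definition stern_tree_sum :: "(real \<Rightarrow> real \<Rightarrow> real) \<Rightarrow> nat \<Rightarrow> real" where
  "stern_tree_sum f N = (\<Sum>n\<in>{2 ^ N..<2 ^ Suc N}.
     f \<bar>real (stern n) - real (stern (n + 1))\<bar> (min (real (stern n)) (real (stern (n + 1)))))"

lemma sum_dyadic_step:
  fixes h :: "nat \<Rightarrow> real"
  assumes "a \<le> b"
  shows "(\<Sum>n\<in>{2 * a..<2 * b}. h n) = (\<Sum>n\<in>{a..<b}. h (2 * n) + h (2 * n + 1))"
  using assms by (induction rule: dec_induct) simp_all

lemma stern_tree_sum_0: "stern_tree_sum f 0 = f 0 1"
proof -
  have "{2 ^ 0..<2 ^ Suc 0} = {1::nat}" by auto
  moreover have "stern (Suc (Suc 0)) = 1"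
    using stern_even[of 1] stern_1 by (simp add: numeral_2_eq_2)
  ultimately show ?thesis using stern_1 by (simp add: stern_tree_sum_def)
qed

text \<open>The children of a pair \<open>(a, b)\<close> are \<open>(a, a + b)\<close> and
  \<open>(a + b, b)\<close>, whose coordinates are \<open>(b, a)\<close> and \<open>(a, b)\<close>.
  Which of them is B and which is C depends on the order of \<open>a\<close> and \<open>b\<close>,
  but the sum over both does not.\<close>

lemma stern_tree_sum_Suc:
  "stern_tree_sum f (Suc N) = stern_tree_sum (\<lambda>x y. f y (x + y) + f (x + y) y) N"
proof -
  define h where "h n =
     f \<bar>real (stern n) - real (stern (n + 1))\<bar> (min (real (stern n)) (real (stern (n + 1))))" for n
  have "stern_tree_sum f (Suc N) = (\<Sum>n\<in>{2 * 2 ^ N..<2 * 2 ^ Suc N}. h n)"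
    by (simp add: stern_tree_sum_def h_def)
  also have "\<dots> = (\<Sum>n\<in>{2 ^ N..<2 ^ Suc N}. h (2 * n) + h (2 * n + 1))"
    by (rule sum_dyadic_step) simp
  also have "\<dots> = stern_tree_sum (\<lambda>x y. f y (x + y) + f (x + y) y) N"
    unfolding stern_tree_sum_def
  proof (rule sum.cong[OF refl])
    fix n :: nat assume "n \<in> {2 ^ N..<2 ^ Suc N}"
    then have "n \<ge> 1" using one_le_power[of "2::nat" N] by (simp del: one_le_power)
    define a b where "a = real (stern n)" and "b = real (stern (n + 1))"
    have "2 * n + 1 + 1 = 2 * (n + 1)" by simp
    then have s: "real (stern (2 * n)) = a" "real (stern (2 * n + 1)) = a + b"
      "real (stern (2 * n + 1 + 1)) = b"
      using stern_even[OF \<open>n \<ge> 1\<close>] stern_odd[OF \<open>n \<ge> 1\<close>] stern_even[of "n + 1"]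
      by (simp_all only: a_def b_def of_nat_add)
    have h2: "h (2 * n) = f b a" "h (2 * n + 1) = f a b"
      unfolding h_def s by (simp_all add: a_def b_def)
    show "h (2 * n) + h (2 * n + 1) =
        f (min (real (stern n)) (real (stern (n + 1))))
          (\<bar>real (stern n) - real (stern (n + 1))\<bar> + min (real (stern n)) (real (stern (n + 1)))) +
        f (\<bar>real (stern n) - real (stern (n + 1))\<bar> + min (real (stern n)) (real (stern (n + 1))))
          (min (real (stern n)) (real (stern (n + 1))))"
      unfolding h2 a_def[symmetric] b_def[symmetric]
      by (cases "a \<le> b") (simp_all add: min_def)
  qed
  finally show ?thesis .
qed

lemma stern_tree_sum_mono:
  assumes "\<And>x y. 0 \<le> x \<Longrightarrow> 0 \<le> y \<Longrightarrow> f x y \<le> g x y"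
  shows "stern_tree_sum f N \<le> stern_tree_sum g N"
  unfolding stern_tree_sum_def by (rule sum_mono) (simp add: assms)

lemma stern_tree_sum_cmult: "stern_tree_sum (\<lambda>x y. c * f x y) N = c * stern_tree_sum f N"
  by (simp add: stern_tree_sum_def sum_distrib_left)

text \<open>Each level contributes a factor \<open>l\<close>, and the recursion ends at the root
  pair with both values 1, whose coordinates are \<open>(0, 1)\<close>.\<close>

lemma stern_tree_sum_le_power:
  assumes "\<And>x y. 0 \<le> x \<Longrightarrow> 0 \<le> y \<Longrightarrow> f y (x + y) + f (x + y) y \<le> l * f x y" "0 \<le> l"
  shows "stern_tree_sum f N \<le> l ^ N * f 0 1"
proof (induction N)
  case (Suc N)
  have "stern_tree_sum f (Suc N) \<le> stern_tree_sum (\<lambda>x y. l * f x y) N"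
    unfolding stern_tree_sum_Suc by (rule stern_tree_sum_mono) (rule assms(1))
  also have "\<dots> \<le> l * (l ^ N * f 0 1)"
    unfolding stern_tree_sum_cmult using Suc assms(2) by (rule mult_left_mono)
  finally show ?case by (simp add: mult_ac)
qed (simp add: stern_tree_sum_0)

lemma stern_tree_sum_ge_power:
  assumes "\<And>x y. 0 \<le> x \<Longrightarrow> 0 \<le> y \<Longrightarrow> l * f x y \<le> f y (x + y) + f (x + y) y" "0 \<le> l"
  shows "l ^ N * f 0 1 \<le> stern_tree_sum f N"
proof (induction N)
  case (Suc N)
  have "l * (l ^ N * f 0 1) \<le> stern_tree_sum (\<lambda>x y. l * f x y) N"
    unfolding stern_tree_sum_cmult using Suc assms(2) by (rule mult_left_mono)
  also have "\<dots> \<le> stern_tree_sum f (Suc N)"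
    unfolding stern_tree_sum_Suc by (rule stern_tree_sum_mono) (rule assms(1))
  finally show ?case by (simp add: mult_ac)
qed (simp add: stern_tree_sum_0)

section \<open>Comparison of the moments with the tree sums\<close>

lemma stern_moment_eq_Suc:
  "stern_moment k N = (\<Sum>n\<in>{2 ^ N..<2 ^ Suc N}. stern (n + 1) ^ k)"
  unfolding stern_moment_def
  by (rule sum.reindex_bij_witness[of _ "\<lambda>n. n + 1" "\<lambda>n. n - 1"]) auto

lemma stern_power2: "stern (2 ^ N) = 1"
  by (induction N) (simp_all add: stern_1[simplified] stern_even)

text \<open>A tree level is closed on the left, the block of \<open>stern_moment\<close> on the
  right; passing between them exchanges the end terms, which are both 1.\<close>

lemma stern_moment_eq:
  "stern_moment k N = (\<Sum>n\<in>{2 ^ N..<2 ^ Suc N}. stern n ^ k)"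
proof -
  have le: "(2::nat) ^ N \<le> 2 ^ Suc N" by simp
  have "(\<Sum>n\<in>{2 ^ N..<2 ^ Suc N}. stern n ^ k) + stern (2 ^ Suc N) ^ k
      = (\<Sum>n\<in>{2 ^ N..2 ^ Suc N}. stern n ^ k)"
    using le by (rule sum.last_plus[symmetric, THEN trans[OF add.commute]])
  also have "\<dots> = stern (2 ^ N) ^ k + (\<Sum>n\<in>{2 ^ N<..2 ^ Suc N}. stern n ^ k)"
    using le by (rule sum.head)
  finally have "(\<Sum>n\<in>{2 ^ N..<2 ^ Suc N}. stern n ^ k) + stern (2 ^ Suc N) ^ k
      = stern (2 ^ N) ^ k + (\<Sum>n\<in>{2 ^ N<..2 ^ Suc N}. stern n ^ k)" .
  then show ?thesis by (simp del: power_Suc add: stern_power2 stern_moment_def)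
qed

lemma stern_moment_le_tree_sum:
  assumes "\<And>x y. 0 \<le> x \<Longrightarrow> 0 \<le> y \<Longrightarrow> (x + y) ^ k \<le> f x y"
  shows "real (stern_moment k N) \<le> stern_tree_sum f N"
proof -
  have "real (stern_moment k N) = (\<Sum>n\<in>{2 ^ N..<2 ^ Suc N}. real (stern (n + 1)) ^ k)"
    by (simp add: stern_moment_eq_Suc)
  also have "\<dots> \<le> stern_tree_sum f N"
    unfolding stern_tree_sum_def
  proof (rule sum_mono)
    fix n
    let ?x = "\<bar>real (stern n) - real (stern (n + 1))\<bar>"
      and ?y = "min (real (stern n)) (real (stern (n + 1)))"
    have "real (stern (n + 1)) ^ k \<le> (?x + ?y) ^ k" by (rule power_mono) auto
    also have "\<dots> \<le> f ?x ?y" by (rule assms) auto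
    finally show "real (stern (n + 1)) ^ k \<le> f ?x ?y" .
  qed
  finally show ?thesis .
qed

text \<open>Since \<open>x + y\<close> is the larger value of a pair, its power is at most the sum
  of both powers. The left and the right members each sum to the moment, whence the factor
  2.\<close>

lemma tree_sum_le_stern_moment:
  assumes "\<And>x y. 0 \<le> x \<Longrightarrow> 0 \<le> y \<Longrightarrow> f x y \<le> c * (x + y) ^ k" "0 \<le> c"
  shows "stern_tree_sum f N \<le> 2 * c * real (stern_moment k N)"
proof -
  have "stern_tree_sum f N \<le>
      (\<Sum>n\<in>{2 ^ N..<2 ^ Suc N}. c * real (stern n) ^ k + c * real (stern (n + 1)) ^ k)"
    unfolding stern_tree_sum_def
  proof (rule sum_mono)
    fix n
    define a b where "a = real (stern n)" and "b = real (stern (n + 1))"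
    have "f \<bar>a - b\<bar> (min a b) \<le> c * (\<bar>a - b\<bar> + min a b) ^ k"
      by (rule assms) (auto simp: a_def b_def)
    also have "\<bar>a - b\<bar> + min a b = max a b" by auto
    also have "c * max a b ^ k \<le> c * (a ^ k + b ^ k)"
      using assms(2) by (intro mult_left_mono) (auto simp: max_def a_def b_def)
    finally show "f \<bar>real (stern n) - real (stern (n + 1))\<bar>
        (min (real (stern n)) (real (stern (n + 1))))
      \<le> c * real (stern n) ^ k + c * real (stern (n + 1)) ^ k"
      by (simp add: a_def b_def distrib_left)
  qed
  also have "\<dots> = c * real (stern_moment k N) + c * real (stern_moment k N)"
    unfolding sum.distrib sum_distrib_left[symmetric]
    by (subst (1) stern_moment_eq, subst (1) stern_moment_eq_Suc) simp
  finally show ?thesis by simp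
qed

section \<open>From geometric bounds to the growth rate\<close>

lemma asymp_equiv_power_rate_le:
  fixes s D l c :: real
  assumes eq: "M \<sim>[at_top] (\<lambda>N. D * s ^ N)" and "0 < s" "0 < D" "0 < l"
    and le: "\<And>N. M N \<le> c * l ^ N"
  shows "s \<le> l"
proof (rule ccontr)
  assume "\<not> s \<le> l"
  have lim: "(\<lambda>N. M N / (D * s ^ N)) \<longlonglongrightarrow> 1"
    by (rule asymp_equivD_strong[OF eq]) (use assms(2,3) in simp)
  \<comment> \<open>If \<open>l < s\<close>, this geometric sequence tends to 0 while dominating a
    ratio that tends to 1.\<close>
  have "(\<lambda>N. c / D * (l / s) ^ N) \<longlonglongrightarrow> c / D * 0"
    by (intro tendsto_mult tendsto_const LIMSEQ_power_zero) (use assms(2,4) \<open>\<not> s \<le> l\<close> in simp)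
  moreover have "M N / (D * s ^ N) \<le> c / D * (l / s) ^ N" for N
    using le[of N] assms(2,3) by (simp add: power_divide field_simps)
  ultimately have "(1::real) \<le> c / D * 0"
    by (intro LIMSEQ_le[OF lim]) auto
  then show False by simp
qed

lemma asymp_equiv_power_rate_ge:
  fixes s D l c :: real
  assumes eq: "M \<sim>[at_top] (\<lambda>N. D * s ^ N)" and "0 < s" "0 < D" "0 < l" "0 < c"
    and le: "\<And>N. c * l ^ N \<le> M N"
  shows "l \<le> s"
proof (rule ccontr)
  assume "\<not> l \<le> s"
  have "(\<lambda>N. M N / (D * s ^ N)) \<longlonglongrightarrow> 1"
    by (rule asymp_equivD_strong[OF eq]) (use assms(2,3) in simp)
  then have lim: "(\<lambda>N. (M N / (D * s ^ N)) * (s / l) ^ N) \<longlonglongrightarrow> 1 * 0"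
    by (intro tendsto_mult LIMSEQ_power_zero) (use assms(2,4) \<open>\<not> l \<le> s\<close> in simp_all)
  have "c / D \<le> (M N / (D * s ^ N)) * (s / l) ^ N" for N
    using le[of N] assms(2-4) by (simp add: power_divide field_simps)
  then have "c / D \<le> 1 * 0"
    by (intro LIMSEQ_le_const[OF lim]) auto
  then show False using assms(3,5) by (simp add: divide_le_0_iff)
qed

section \<open>Linear forms in the eigenbasis of the step B\<close>

definition golden_form :: "real \<Rightarrow> real \<Rightarrow> real" where
  "golden_form x y = x + golden * y"

text \<open>The eigenform of B for the other eigenvalue \<open>- 1 / golden\<close>: the algebraic
  conjugate of \<open>golden_form\<close>, scaled by \<open>golden\<close>.\<close>

definition conj_form :: "real \<Rightarrow> real \<Rightarrow> real" where
  "conj_form x y = golden * x - y"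

text \<open>Up to the factor \<open>golden ^ j\<close>, this is \<open>golden_form\<close> after \<open>j\<close> steps
  \<open>(x, y) \<mapsto> (y, x + y)\<close> followed by one step \<open>(x, y) \<mapsto> (x + y, y)\<close>, written in the
  eigenbasis \<open>golden_form\<close>, \<open>conj_form\<close> of the first kind of step.\<close>
definition step_form :: "nat \<Rightarrow> real \<Rightarrow> real \<Rightarrow> real" where
  "step_form j x y = golden * delta2 * golden_form x y
     - (- 1 / golden\<^sup>2) ^ j * ((3 - golden) / 5 * conj_form x y)"

lemma golden_delta2: "golden * delta2 = (2 * golden + 4) / 5"
  by (simp add: golden_def delta2_def field_simps)

lemma golden_mult_golden: "golden * (golden * x) = golden * x + x"
  using golden_sq by (metis distrib_right mult.assoc mult_1)

lemma golden_form_swap: "golden_form y (x + y) = golden * golden_form x y"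
  by (simp add: golden_form_def distrib_left golden_mult_golden)

lemma conj_form_swap: "golden * conj_form y (x + y) = - conj_form x y"
  by (simp add: conj_form_def right_diff_distrib distrib_left golden_mult_golden)

text \<open>B multiplies the two eigenforms by \<open>golden\<close> and
  \<open>- 1 / golden\<close>; after taking out \<open>golden\<close>, the conjugate part has gained
  one factor \<open>- 1 / golden\<^sup>2\<close>.\<close>

lemma step_form_swap: "step_form j y (x + y) = golden * step_form (Suc j) x y"
proof -
  have "conj_form x y = - golden * conj_form y (x + y)"
    using conj_form_swap[of y x] by simp
  then show ?thesis
    unfolding step_form_def golden_form_swap
    using golden_pos by (simp add: power2_eq_square right_diff_distrib)
qed

text \<open>This identity is where the coefficients of \<open>step_form\<close> come from: they are
  the coordinates of \<open>golden_form (x + y) y\<close> in the eigenbasis.\<close>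

lemma step_form_0: "step_form 0 x y = golden_form (x + y) y"
  unfolding step_form_def golden_delta2
  by (simp add: golden_form_def conj_form_def field_simps golden_mult_golden)

lemma golden_form_nonneg: "0 \<le> x \<Longrightarrow> 0 \<le> y \<Longrightarrow> 0 \<le> golden_form x y"
  using golden_pos by (simp add: golden_form_def)

lemma abs_conj_form_le:
  assumes "0 \<le> x" "0 \<le> y"
  shows "\<bar>conj_form x y\<bar> \<le> golden * golden_form x y"
  using assms golden_mult_bounds[OF assms(1)] golden_mult_bounds[OF assms(2)]
  by (simp add: conj_form_def golden_form_def distrib_left golden_mult_golden abs_le_iff)

text \<open>The conjugate part decays like \<open>golden\<close> to the power \<open>-2 * j\<close>,
  so after a long run of B one C costs the factor \<open>delta2\<close> up to this relative error.
  Both main estimates use it with \<open>j = k\<close>.\<close>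

lemma step_form_approx:
  assumes "0 \<le> x" "0 \<le> y"
  shows "\<bar>step_form j x y - golden * delta2 * golden_form x y\<bar>
    \<le> (1 / golden\<^sup>2) ^ j * (golden * delta2 * golden_form x y)"
proof -
  have P: "0 \<le> golden_form x y" by (rule golden_form_nonneg[OF assms])
  have "\<bar>(3 - golden) / 5 * conj_form x y\<bar> = (3 - golden) / 5 * \<bar>conj_form x y\<bar>"
    using golden_bounds by (simp add: abs_mult)
  also have "\<dots> \<le> (3 - golden) / 5 * (golden * golden_form x y)"
    using golden_bounds abs_conj_form_le[OF assms] by (intro mult_left_mono) auto
  also have "\<dots> = (2 * golden - 1) / 5 * golden_form x y"
    by (simp add: field_simps golden_mult_golden)
  also have "\<dots> \<le> golden * delta2 * golden_form x y"
    unfolding golden_delta2 using P by (intro mult_right_mono) auto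
  finally have "(1 / golden\<^sup>2) ^ j * \<bar>(3 - golden) / 5 * conj_form x y\<bar>
      \<le> (1 / golden\<^sup>2) ^ j * (golden * delta2 * golden_form x y)"
    by (intro mult_left_mono) simp_all
  then show ?thesis
    by (simp add: step_form_def abs_mult power_abs)
qed

lemma golden_power_le_1: "(1 / golden\<^sup>2) ^ j \<le> 1"
  using golden_bounds by (intro power_le_one) (auto simp: power2_eq_square golden_sq)

lemma delta2_pos: "0 < delta2"
  by (simp add: delta2_def)

lemma step_form_nonneg:
  assumes "0 \<le> x" "0 \<le> y"
  shows "0 \<le> step_form j x y"
proof -
  have "0 \<le> golden * delta2 * golden_form x y"
    using golden_form_nonneg[OF assms] golden_pos delta2_pos by simp
  then have "(1 / golden\<^sup>2) ^ j * (golden * delta2 * golden_form x y)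
      \<le> 1 * (golden * delta2 * golden_form x y)"
    by (intro mult_right_mono golden_power_le_1)
  then show ?thesis using step_form_approx[OF assms, of j] by linarith
qed

text \<open>The extremal case is \<open>j = 1\<close>.\<close>
lemma step_form_step_le:
  assumes "0 \<le> x" "0 \<le> y"
  shows "step_form j (x + y) y \<le> golden\<^sup>2 * (0.619 * x + 1.4725 * y)"
proof -
  have Q: "0 \<le> conj_form (x + y) y"
    using assms golden_mult_bounds[OF assms(1)] golden_mult_bounds[OF assms(2)]
    by (simp add: conj_form_def distrib_left)
  have inv: "1 / golden\<^sup>2 \<le> 0.382"
  proof -
    have "golden\<^sup>2 = golden + 1" by (simp add: power2_eq_square golden_sq)
    then show ?thesis using golden_bounds by (simp add: field_simps)
  qed
  \<comment> \<open>As \<open>conj_form (x + y) y\<close> is nonnegative, only an upper bound for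
    this alternating coefficient matters.\<close>
  have e: "- ((- 1 / golden\<^sup>2) ^ j) \<le> 0.382"
  proof (cases "even j")
    case True
    then have "0 \<le> (- 1 / golden\<^sup>2) ^ j" by (rule zero_le_even_power)
    then show ?thesis by simp
  next
    case False
    then have "j \<ge> 1" by (cases j) auto
    have "- ((- 1 / golden\<^sup>2) ^ j) = (1 / golden\<^sup>2) ^ j"
      using False by (simp add: power_divide)
    also have "\<dots> \<le> (1 / golden\<^sup>2) ^ 1"
      using golden_power_le_1[of 1] \<open>j \<ge> 1\<close> by (intro power_decreasing) auto
    finally show ?thesis using inv by simp
  qed
  have "- ((- 1 / golden\<^sup>2) ^ j) * ((3 - golden) / 5 * conj_form (x + y) y)
      \<le> 0.382 * ((3 - golden) / 5 * conj_form (x + y) y)"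
    using Q golden_bounds by (intro mult_right_mono e) auto
  then have "step_form j (x + y) y
      \<le> golden * delta2 * golden_form (x + y) y + 0.382 * ((3 - golden) / 5 * conj_form (x + y) y)"
    by (simp add: step_form_def)
  also have "\<dots> \<le> golden\<^sup>2 * (0.619 * x + 1.4725 * y)"
    unfolding golden_delta2
    using assms golden_mult_bounds[OF assms(1)] golden_mult_bounds[OF assms(2)]
    by (simp add: golden_form_def conj_form_def power2_eq_square field_simps
        golden_mult_golden)
  finally show ?thesis .
qed

section \<open>The gauge for words with at least two letters C\<close>

text \<open>The second form is, slightly enlarged, the normalised form of the word \<open>C B C\<close>; the third
  one is its image under \<open>B\<close>, and a further \<open>B\<close> leads below a convex combination of the first two.\<close>
definition gauge :: "real \<Rightarrow> real \<Rightarrow> real" where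
  "gauge x y = max (0.836 * golden_form x y)
     (max (0.619 * x + 1.4725 * y) (0.911 * x + 1.294 * y))"

lemma gauge_nonneg:
  assumes "0 \<le> x" "0 \<le> y"
  shows "0 \<le> gauge x y"
  unfolding gauge_def using golden_form_nonneg[OF assms] by (simp add: le_max_iff_disj)

text \<open>The part \<open>golden_form\<close> is an eigenform and cannot contract after division
  by \<open>golden\<close>; the other two forms can. Keeping them apart in the maximum lets the
  first be charged to \<open>golden_form\<close> and the second be absorbed, as
  \<open>0.999 ^ k\<close> becomes small.\<close>

lemma gauge_swap:
  assumes "0 \<le> x" "0 \<le> y"
  shows "gauge y (x + y) \<le> golden * max (0.836 * golden_form x y) (0.999 * gauge x y)"
    (is "_ \<le> golden * ?m")
proof -
  note b = golden_mult_bounds[OF assms(1)] golden_mult_bounds[OF assms(2)]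
  have q: "0.619 * x + 1.4725 * y \<le> gauge x y" "0.911 * x + 1.294 * y \<le> gauge x y"
    unfolding gauge_def by linarith+
  have m: "0.836 * golden_form x y \<le> ?m" "0.999 * (0.619 * x + 1.4725 * y) \<le> ?m"
    "0.999 * (0.911 * x + 1.294 * y) \<le> ?m"
    using q by (simp_all add: le_max_iff_disj)
  then have gm: "golden * (0.836 * golden_form x y) \<le> golden * ?m"
    "golden * (0.999 * (0.619 * x + 1.4725 * y)) \<le> golden * ?m"
    "golden * (0.999 * (0.911 * x + 1.294 * y)) \<le> golden * ?m"
    using golden_pos by simp_all
  have "0.836 * golden_form y (x + y) \<le> golden * ?m"
    using gm(1) by (simp add: golden_form_swap)
  moreover have "0.619 * y + 1.4725 * (x + y) \<le> golden * ?m"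
  proof -
    have "golden * (0.999 * (0.911 * x + 1.294 * y))
        = 0.910089 * (golden * x) + 1.292706 * (golden * y)"
      by (simp add: field_simps)
    then have "0.619 * y + 1.4725 * (x + y) \<le> golden * (0.999 * (0.911 * x + 1.294 * y))"
      using b assms by (simp add: distrib_left)
    then show ?thesis using gm(3) by linarith
  qed
  moreover have "0.911 * y + 1.294 * (x + y) \<le> golden * ?m"
  proof -
    \<comment> \<open>The coefficient of \<open>x\<close> forces the first weight above 0.83, that
      of \<open>y\<close> below 0.92; 0.87 lies in between.\<close>
    have "0.911 * y + 1.294 * (x + y)
      \<le> 0.87 * (golden * (0.836 * golden_form x y))
        + 0.13 * (golden * (0.999 * (0.619 * x + 1.4725 * y)))"
    proof -
      define X Y where "X = golden * x" and "Y = golden * y"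
      have "0.911 * y + 1.294 * (x + y)
          \<le> 0.87 * (0.836 * (X + Y + y)) + 0.13 * (0.999 * (0.619 * X + 1.4725 * Y))"
        using b assms unfolding X_def[symmetric] Y_def[symmetric] by (simp add: field_simps)
      moreover have "golden * (0.836 * golden_form x y) = 0.836 * (X + Y + y)"
        by (simp add: golden_form_def X_def Y_def field_simps golden_mult_golden)
      moreover have "golden * (0.999 * (0.619 * x + 1.4725 * y)) = 0.999 * (0.619 * X + 1.4725 * Y)"
        by (simp add: X_def Y_def field_simps)
      ultimately show ?thesis by (simp only:)
    qed
    also have "\<dots> \<le> golden * ?m" by (intro convex_bound_le gm) simp_all
    finally show ?thesis .
  qed
  ultimately show ?thesis by (simp add: gauge_def)
qed

text \<open>After a letter C all three forms are dominated by the second form alone.\<close>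

lemma gauge_step:
  assumes "0 \<le> x" "0 \<le> y"
  shows "gauge (x + y) y \<le> golden * (0.95 * gauge x y)"
proof -
  note b = golden_mult_bounds[OF assms(1)] golden_mult_bounds[OF assms(2)]
  have "0.619 * x + 1.4725 * y \<le> gauge x y"
    unfolding gauge_def by linarith
  then have "golden * (0.95 * (0.619 * x + 1.4725 * y)) \<le> golden * (0.95 * gauge x y)"
    using golden_pos by simp
  moreover have "gauge (x + y) y \<le> golden * (0.95 * (0.619 * x + 1.4725 * y))"
  proof -
    have "golden * (0.95 * (0.619 * x + 1.4725 * y)) = 0.58805 * (golden * x) + 1.398875 * (golden * y)"
      by (simp add: field_simps)
    then show ?thesis
      using b assms by (simp add: gauge_def golden_form_def distrib_left)
  qed
  ultimately show ?thesis by linarith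
qed

section \<open>The test function built from words with at most one C\<close>

text \<open>The summand for \<open>j\<close> belongs to the word of \<open>j\<close> letters B
  followed by C, divided by \<open>golden ^ (j + 1)\<close> before taking the power. The weight
  \<open>\<nu>\<close> discounts each letter by the expected growth: it is
  \<open>1 / (1 + \<epsilon>)\<close> in the lower bound and 1 in the upper bound.\<close>

definition base_test :: "real \<Rightarrow> nat \<Rightarrow> real \<Rightarrow> real \<Rightarrow> real" where
  "base_test \<nu> k x y = golden_form x y ^ k + \<nu> * (\<Sum>j<k. \<nu> ^ j * (step_form j x y / golden) ^ k)"

text \<open>B shifts every index \<open>j\<close> to \<open>Suc j\<close>, and the main term after C
  supplies the missing index 0. What remains beyond the original sum is the term with index
  \<open>k\<close>.\<close>

lemma base_test_swap:
  "base_test \<nu> k y (x + y) + golden_form (x + y) y ^ k = golden ^ k *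
     (golden_form x y ^ k + (\<Sum>j<k. \<nu> ^ j * (step_form j x y / golden) ^ k)
      + \<nu> ^ k * (step_form k x y / golden) ^ k)"
proof -
  let ?S = "\<lambda>j. \<nu> ^ j * (step_form j x y / golden) ^ k"
  have "base_test \<nu> k y (x + y) + golden_form (x + y) y ^ k =
      (golden * golden_form x y) ^ k + \<nu> * (\<Sum>j<k. \<nu> ^ j * step_form (Suc j) x y ^ k)
      + step_form 0 x y ^ k"
    using golden_pos by (simp add: base_test_def golden_form_swap step_form_swap step_form_0)
  also have "\<dots> = golden ^ k * (golden_form x y ^ k + ((\<Sum>j<k. ?S (Suc j)) + ?S 0))"
    using golden_pos
    by (simp add: power_mult_distrib power_divide distrib_left sum_distrib_left mult_ac)
  also have "(\<Sum>j<k. ?S (Suc j)) + ?S 0 = (\<Sum>j<Suc k. ?S j)"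
    unfolding sum.lessThan_Suc_shift by simp
  finally show ?thesis by simp
qed

lemma base_test_ge:
  assumes "0 \<le> x" "0 \<le> y" "0 \<le> \<nu>"
  shows "golden_form x y ^ k \<le> base_test \<nu> k x y"
  unfolding base_test_def using assms golden_pos
  by (auto intro!: mult_nonneg_nonneg sum_nonneg zero_le_power divide_nonneg_nonneg step_form_nonneg)

text \<open>Since \<open>(1 + \<epsilon>) * \<nu> = 1\<close>, the sum reproduces itself. The excess
  \<open>\<epsilon>\<close> of the main term is paid for by the leftover term with index
  \<open>k\<close>, which is what the hypothesis on \<open>\<epsilon>\<close> expresses.\<close>

lemma base_test_supersolution:
  assumes xy: "0 \<le> x" "0 \<le> y" and "0 < \<epsilon>"
    and \<epsilon>: "\<epsilon> \<le> (1 / (1 + \<epsilon>)) ^ k * (delta2 * (1 - (1 / golden\<^sup>2) ^ k)) ^ k"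
  shows "golden ^ k * (1 + \<epsilon>) * base_test (1 / (1 + \<epsilon>)) k x y
    \<le> base_test (1 / (1 + \<epsilon>)) k y (x + y) + base_test (1 / (1 + \<epsilon>)) k (x + y) y"
proof -
  define \<nu> where "\<nu> = 1 / (1 + \<epsilon>)"
  define \<kappa> where "\<kappa> = (1 / golden\<^sup>2) ^ k"
  define P where "P = golden_form x y"
  define S where "S = (\<Sum>j<k. \<nu> ^ j * (step_form j x y / golden) ^ k)"
  have \<nu>: "0 \<le> \<nu>" "(1 + \<epsilon>) * \<nu> = 1" using \<open>0 < \<epsilon>\<close> by (simp_all add: \<nu>_def)
  have P: "0 \<le> P" unfolding P_def by (rule golden_form_nonneg[OF xy])
  have \<kappa>: "\<kappa> \<le> 1" unfolding \<kappa>_def by (rule golden_power_le_1)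
  have "golden * delta2 * P - \<kappa> * (golden * delta2 * P) \<le> step_form k x y"
    using step_form_approx[OF xy, of k] unfolding P_def \<kappa>_def by linarith
  then have "delta2 * (1 - \<kappa>) * P \<le> step_form k x y / golden"
    using golden_pos by (simp add: field_simps)
  moreover have "0 \<le> delta2 * (1 - \<kappa>) * P"
    using delta2_pos \<kappa> P by simp
  ultimately have "(delta2 * (1 - \<kappa>) * P) ^ k \<le> (step_form k x y / golden) ^ k"
    by (rule power_mono)
  then have "\<nu> ^ k * (delta2 * (1 - \<kappa>)) ^ k * P ^ k \<le> \<nu> ^ k * (step_form k x y / golden) ^ k"
    using \<nu> by (simp add: power_mult_distrib mult_left_mono mult.assoc)
  moreover have "\<epsilon> * P ^ k \<le> \<nu> ^ k * (delta2 * (1 - \<kappa>)) ^ k * P ^ k"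
    using \<epsilon> P unfolding \<nu>_def \<kappa>_def by (intro mult_right_mono) simp_all
  ultimately have e: "\<epsilon> * P ^ k \<le> \<nu> ^ k * (step_form k x y / golden) ^ k"
    by linarith
  have "(1 + \<epsilon>) * base_test \<nu> k x y = (1 + \<epsilon>) * P ^ k + ((1 + \<epsilon>) * \<nu>) * S"
    by (simp add: base_test_def P_def S_def distrib_left)
  also have "\<dots> \<le> P ^ k + S + \<nu> ^ k * (step_form k x y / golden) ^ k"
    unfolding \<nu> using e by (simp add: distrib_right)
  finally have "golden ^ k * ((1 + \<epsilon>) * base_test \<nu> k x y)
      \<le> golden ^ k * (P ^ k + S + \<nu> ^ k * (step_form k x y / golden) ^ k)"
    using golden_pos by simp
  also have "\<dots> = base_test \<nu> k y (x + y) + golden_form (x + y) y ^ k"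
    unfolding P_def S_def base_test_swap ..
  also have "\<dots> \<le> base_test \<nu> k y (x + y) + base_test \<nu> k (x + y) y"
    using base_test_ge[of "x + y" y \<nu> k] xy \<nu> by simp
  finally show ?thesis by (simp add: \<nu>_def mult.assoc)
qed

text \<open>A crude comparison suffices: the constant may depend on \<open>k\<close>, because it is
  independent of the level and does not affect the growth rate.\<close>

lemma base_test_le:
  assumes xy: "0 \<le> x" "0 \<le> y" and "0 \<le> \<nu>" "\<nu> \<le> 1"
  shows "base_test \<nu> k x y \<le> (1 + real k * 2 ^ k) * golden ^ k * (x + y) ^ k"
proof -
  define P where "P = golden_form x y"
  have P: "0 \<le> P" unfolding P_def by (rule golden_form_nonneg[OF xy])
  have d: "delta2 \<le> 1"
    using real_le_rsqrt[of 2 5] by (simp add: delta2_def)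
  have "\<nu> ^ j * (step_form j x y / golden) ^ k \<le> 2 ^ k * P ^ k" for j
  proof -
    have "(1 / golden\<^sup>2) ^ j * (golden * delta2 * P) \<le> 1 * (golden * delta2 * P)"
      using golden_pos delta2_pos P by (intro mult_right_mono golden_power_le_1) simp
    then have "step_form j x y \<le> 2 * (golden * delta2 * P)"
      using step_form_approx[OF xy, of j] unfolding P_def by linarith
    also have "\<dots> \<le> 2 * (golden * 1 * P)"
      using golden_pos P d by (intro mult_left_mono mult_right_mono) simp_all
    finally have "step_form j x y / golden \<le> 2 * P"
      using golden_pos by (simp add: field_simps)
    then have "(step_form j x y / golden) ^ k \<le> (2 * P) ^ k"
      using golden_pos step_form_nonneg[OF xy] by (intro power_mono) simp_all
    moreover have "\<nu> ^ j \<le> 1" using assms by (intro power_le_one)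
    ultimately have "\<nu> ^ j * (step_form j x y / golden) ^ k \<le> 1 * (2 * P) ^ k"
      using golden_pos step_form_nonneg[OF xy, of j] assms
      by (intro mult_mono) simp_all
    then show ?thesis by (simp add: power_mult_distrib)
  qed
  then have "(\<Sum>j<k. \<nu> ^ j * (step_form j x y / golden) ^ k) \<le> of_nat (card {..<k}) * (2 ^ k * P ^ k)"
    by (intro sum_bounded_above)
  then have "\<nu> * (\<Sum>j<k. \<nu> ^ j * (step_form j x y / golden) ^ k) \<le> 1 * (k * (2 ^ k * P ^ k))"
    using assms golden_pos step_form_nonneg[OF xy]
    by (intro mult_mono) (auto intro!: sum_nonneg mult_nonneg_nonneg)
  then have "base_test \<nu> k x y \<le> (1 + real k * 2 ^ k) * P ^ k"
    by (simp add: base_test_def P_def distrib_right mult.assoc)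
  also have "P \<le> golden * (x + y)"
    using golden_mult_bounds[OF xy(1)] xy by (simp add: P_def golden_form_def distrib_left)
  then have "(1 + real k * 2 ^ k) * P ^ k \<le> (1 + real k * 2 ^ k) * (golden * (x + y)) ^ k"
    using P by (intro mult_left_mono power_mono) simp_all
  finally show ?thesis by (simp add: power_mult_distrib mult.assoc)
qed

section \<open>The test function for the upper bound\<close>

lemma max_power_le_add:
  fixes a b :: real
  assumes "0 \<le> a" "0 \<le> b"
  shows "max a b ^ k \<le> a ^ k + b ^ k"
  using assms by (auto simp: max_def)

text \<open>The weight \<open>2 * k\<close> balances one step: the sum in \<open>base_test\<close>
  after C costs at most \<open>k\<close> gauge powers, and the old gauge powers are at least halved,
  so \<open>k + 2 * k / 2 = 2 * k\<close>.\<close>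

definition gauge_test :: "nat \<Rightarrow> real \<Rightarrow> real \<Rightarrow> real" where
  "gauge_test k x y = base_test 1 k x y + 2 * k * gauge x y ^ k"

lemma gauge_test_subsolution:
  assumes xy: "0 \<le> x" "0 \<le> y" and k: "0.999 ^ k + 0.95 ^ k \<le> (1 / 2 :: real)"
    and \<epsilon>: "(delta2 * (1 + (1 / golden\<^sup>2) ^ k)) ^ k + 2 * k * 0.836 ^ k \<le> \<epsilon>"
  shows "gauge_test k y (x + y) + gauge_test k (x + y) y \<le> golden ^ k * (1 + \<epsilon>) * gauge_test k x y"
proof -
  define \<kappa> where "\<kappa> = (1 / golden\<^sup>2) ^ k"
  define P where "P = golden_form x y"
  define G where "G = gauge x y"
  define S where "S = (\<Sum>j<k. (step_form j x y / golden) ^ k)"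
  have P: "0 \<le> P" unfolding P_def by (rule golden_form_nonneg[OF xy])
  have G: "0 \<le> G" unfolding G_def by (rule gauge_nonneg[OF xy])
  have \<kappa>: "0 \<le> \<kappa>" by (simp add: \<kappa>_def)
  have "0 \<le> (delta2 * (1 + \<kappa>)) ^ k + 2 * k * 0.836 ^ k"
    using delta2_pos \<kappa> by simp
  then have \<epsilon>0: "0 \<le> \<epsilon>" using \<epsilon> unfolding \<kappa>_def by linarith
  have "step_form k x y \<le> golden * delta2 * P + \<kappa> * (golden * delta2 * P)"
    using step_form_approx[OF xy, of k] unfolding P_def \<kappa>_def by linarith
  then have "step_form k x y / golden \<le> delta2 * (1 + \<kappa>) * P"
    using golden_pos by (simp add: field_simps)
  then have last: "(step_form k x y / golden) ^ k \<le> (delta2 * (1 + \<kappa>)) ^ k * P ^ k"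
    unfolding power_mult_distrib[symmetric]
    using step_form_nonneg[OF xy] golden_pos by (intro power_mono) simp_all
  \<comment> \<open>These summands describe words with two letters C; each is bounded by the gauge
    through \<open>step_form_step_le\<close>.\<close>
  have "base_test 1 k (x + y) y \<le> golden_form (x + y) y ^ k + golden ^ k * (k * G ^ k)"
  proof -
    have "(step_form j (x + y) y / golden) ^ k \<le> (golden * G) ^ k" for j
    proof (rule power_mono)
      have "step_form j (x + y) y \<le> golden\<^sup>2 * (0.619 * x + 1.4725 * y)"
        by (rule step_form_step_le[OF xy])
      also have "\<dots> \<le> golden\<^sup>2 * G"
        unfolding G_def gauge_def by (intro mult_left_mono) (linarith, simp)
      finally show "step_form j (x + y) y / golden \<le> golden * G"
        using golden_pos by (simp add: field_simps power2_eq_square)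
    qed (use golden_pos step_form_nonneg[of "x + y" y] xy in simp)
    then have "(\<Sum>j<k. (step_form j (x + y) y / golden) ^ k) \<le> of_nat (card {..<k}) * (golden * G) ^ k"
      by (intro sum_bounded_above)
    then show ?thesis by (simp add: base_test_def power_mult_distrib mult_ac)
  qed
  then have base: "base_test 1 k y (x + y) + base_test 1 k (x + y) y
      \<le> golden ^ k * (P ^ k + S + (delta2 * (1 + \<kappa>)) ^ k * P ^ k + k * G ^ k)"
  proof -
    have "base_test 1 k y (x + y) + golden_form (x + y) y ^ k
        = golden ^ k * (P ^ k + S + (step_form k x y / golden) ^ k)"
      by (simp add: base_test_swap P_def S_def)
    also have "\<dots> \<le> golden ^ k * (P ^ k + S + (delta2 * (1 + \<kappa>)) ^ k * P ^ k)"
      using last golden_pos by (intro mult_left_mono add_left_mono) simp_all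
    finally show ?thesis
      using \<open>base_test 1 k (x + y) y \<le> _\<close>
      unfolding distrib_left[of "golden ^ k" _ "k * G ^ k"] by linarith
  qed
  have "gauge y (x + y) ^ k \<le> (golden * max (0.836 * P) (0.999 * G)) ^ k"
    unfolding P_def G_def using gauge_swap[OF xy] gauge_nonneg[of y "x + y"] xy
    by (intro power_mono) simp_all
  also have "\<dots> \<le> golden ^ k * ((0.836 * P) ^ k + (0.999 * G) ^ k)"
    unfolding power_mult_distrib[of golden] using P G golden_pos
    by (intro mult_left_mono max_power_le_add) simp_all
  finally have g1: "gauge y (x + y) ^ k \<le> golden ^ k * (0.836 ^ k * P ^ k + 0.999 ^ k * G ^ k)"
    by (simp only: power_mult_distrib)
  have "gauge (x + y) y ^ k \<le> (golden * (0.95 * G)) ^ k"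
    unfolding G_def using gauge_step[OF xy] gauge_nonneg[of "x + y" y] xy
    by (intro power_mono) simp_all
  then have g2: "gauge (x + y) y ^ k \<le> golden ^ k * (0.95 ^ k * G ^ k)"
    by (simp only: power_mult_distrib)
  have "gauge y (x + y) ^ k + gauge (x + y) y ^ k
      \<le> golden ^ k * (0.836 ^ k * P ^ k + (0.999 ^ k + 0.95 ^ k) * G ^ k)"
    using g1 g2 by (simp add: algebra_simps)
  also have "\<dots> \<le> golden ^ k * (0.836 ^ k * P ^ k + 1 / 2 * G ^ k)"
    using golden_pos G k by (intro mult_left_mono add_left_mono mult_right_mono) simp_all
  finally have "2 * k * (gauge y (x + y) ^ k + gauge (x + y) y ^ k)
      \<le> 2 * k * (golden ^ k * (0.836 ^ k * P ^ k + 1 / 2 * G ^ k))"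
    by (intro mult_left_mono) simp_all
  then have "gauge_test k y (x + y) + gauge_test k (x + y) y
      \<le> golden ^ k * (P ^ k + S + (delta2 * (1 + \<kappa>)) ^ k * P ^ k + k * G ^ k)
        + 2 * k * (golden ^ k * (0.836 ^ k * P ^ k + 1 / 2 * G ^ k))"
    using base unfolding gauge_test_def distrib_left by linarith
  also have "\<dots> = golden ^ k * (P ^ k + S + 2 * k * G ^ k
      + ((delta2 * (1 + \<kappa>)) ^ k + 2 * k * 0.836 ^ k) * P ^ k)"
    by (simp add: algebra_simps del: power_mult_distrib)
  \<comment> \<open>What is left over is a multiple of \<open>P ^ k\<close>, which the test function
    dominates; it becomes the increase \<open>\<epsilon>\<close> of the rate.\<close>
  also have "\<dots> \<le> golden ^ k * (P ^ k + S + 2 * k * G ^ k + \<epsilon> * gauge_test k x y)"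
  proof (intro mult_left_mono add_left_mono mult_mono)
    show "P ^ k \<le> gauge_test k x y"
      using base_test_ge[OF xy, of 1 k] G by (simp add: gauge_test_def P_def G_def add_increasing2)
  qed (use \<epsilon> \<epsilon>0 P golden_pos in \<open>simp_all add: \<kappa>_def\<close>)
  also have "P ^ k + S + 2 * k * G ^ k = gauge_test k x y"
    by (simp add: gauge_test_def base_test_def P_def S_def G_def)
  finally show ?thesis by (simp add: distrib_left distrib_right mult.assoc)
qed

section \<open>Bounds for the growth rate of the moments\<close>

lemma stern_rate_ge:
  fixes s D :: real
  assumes "0 < s" "0 < D" and eq: "(\<lambda>N. real (stern_moment k N)) \<sim>[at_top] (\<lambda>N. D * s ^ N)"
    and \<epsilon>: "0 < \<epsilon>" "\<epsilon> \<le> (1 / (1 + \<epsilon>)) ^ k * (delta2 * (1 - (1 / golden\<^sup>2) ^ k)) ^ k"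
  shows "golden ^ k * (1 + \<epsilon>) \<le> s"
proof -
  define c where "c = (1 + real k * 2 ^ k) * golden ^ k"
  define f where "f = base_test (1 / (1 + \<epsilon>)) k"
  have c: "0 < c" using golden_pos by (simp add: c_def add_pos_nonneg)
  have "0 < golden_form 0 1 ^ k" using golden_pos by (simp add: golden_form_def)
  also have "\<dots> \<le> f 0 1" unfolding f_def by (rule base_test_ge) (use \<epsilon> in simp_all)
  finally have f: "0 < f 0 1" .
  show ?thesis
  proof (rule asymp_equiv_power_rate_ge[OF eq assms(1,2)])
    show "0 < golden ^ k * (1 + \<epsilon>)" using golden_pos \<epsilon> by simp
    show "0 < f 0 1 / (2 * c)" using f c by simp
    fix N
    have "(golden ^ k * (1 + \<epsilon>)) ^ N * f 0 1 \<le> stern_tree_sum f N"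
      unfolding f_def using \<epsilon> golden_pos
      by (intro stern_tree_sum_ge_power base_test_supersolution) simp_all
    also have "\<dots> \<le> 2 * c * real (stern_moment k N)"
    proof (rule tree_sum_le_stern_moment)
      fix x y :: real assume "0 \<le> x" "0 \<le> y"
      then show "f x y \<le> c * (x + y) ^ k"
        unfolding f_def c_def using \<epsilon> by (intro base_test_le) simp_all
    qed (use c in simp)
    finally show "f 0 1 / (2 * c) * (golden ^ k * (1 + \<epsilon>)) ^ N \<le> real (stern_moment k N)"
      using c by (simp add: field_simps)
  qed
qed

lemma stern_rate_le:
  fixes s D :: real
  assumes "0 < s" "0 < D" and eq: "(\<lambda>N. real (stern_moment k N)) \<sim>[at_top] (\<lambda>N. D * s ^ N)"
    and k: "0.999 ^ k + 0.95 ^ k \<le> (1 / 2 :: real)"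
    and \<epsilon>: "(delta2 * (1 + (1 / golden\<^sup>2) ^ k)) ^ k + 2 * k * 0.836 ^ k \<le> \<epsilon>"
  shows "s \<le> golden ^ k * (1 + \<epsilon>)"
proof -
  have "0 \<le> (delta2 * (1 + (1 / golden\<^sup>2) ^ k)) ^ k + 2 * k * 0.836 ^ k"
    using delta2_pos by simp
  then have \<epsilon>0: "0 \<le> \<epsilon>" using \<epsilon> by linarith
  show ?thesis
  proof (rule asymp_equiv_power_rate_le[OF eq assms(1,2)])
    show "0 < golden ^ k * (1 + \<epsilon>)" using golden_pos \<epsilon>0 by simp
    fix N
    have "real (stern_moment k N) \<le> stern_tree_sum (gauge_test k) N"
    proof (rule stern_moment_le_tree_sum)
      fix x y :: real assume xy: "0 \<le> x" "0 \<le> y"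
      have "(x + y) ^ k \<le> golden_form x y ^ k"
        using xy golden_mult_bounds[OF xy(2)] by (intro power_mono) (simp_all add: golden_form_def)
      also have "\<dots> \<le> base_test 1 k x y" using xy by (intro base_test_ge) simp_all
      also have "\<dots> \<le> gauge_test k x y" using gauge_nonneg[OF xy] by (simp add: gauge_test_def)
      finally show "(x + y) ^ k \<le> gauge_test k x y" .
    qed
    also have "\<dots> \<le> (golden ^ k * (1 + \<epsilon>)) ^ N * gauge_test k 0 1"
      using k \<epsilon> \<epsilon>0 golden_pos by (intro stern_tree_sum_le_power gauge_test_subsolution) simp_all
    finally show "real (stern_moment k N) \<le> gauge_test k 0 1 * (golden ^ k * (1 + \<epsilon>)) ^ N"
      by (simp add: mult.commute)
  qed
qed

section \<open>Elementary estimates for the error terms\<close>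

text \<open>By convexity in \<open>t\<close>, the power lies below its chord between
  \<open>t = 0\<close> and \<open>t = 1\<close>.\<close>

lemma one_plus_power_le:
  fixes t :: real
  assumes "0 \<le> t" "t \<le> 1"
  shows "(1 + t) ^ k \<le> 1 + (2 ^ k - 1) * t"
proof (induction k)
  case (Suc k)
  have "(1 + t) ^ Suc k \<le> (1 + t) * (1 + (2 ^ k - 1) * t)"
    using Suc assms by (simp add: mult_left_mono)
  also have "\<dots> = 1 + 2 ^ k * t + (2 ^ k - 1) * (t * t)"
    by (simp add: algebra_simps)
  also have "\<dots> \<le> 1 + 2 ^ k * t + (2 ^ k - 1) * t"
    using assms mult_left_mono[of t 1 t] by (intro add_left_mono mult_left_mono) simp_all
  finally show ?case by (simp add: algebra_simps)
qed simp

lemma linear_times_power_bound: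
  fixes a b :: real
  assumes "0 \<le> a" "a < b"
  shows "\<exists>C. \<forall>k. real k * a ^ k \<le> C * b ^ k"
proof -
  have "(\<lambda>k. real k * (a / b) ^ k) \<longlonglongrightarrow> 0"
    using assms by (intro powser_times_n_limit_0) simp
  then have "Bseq (\<lambda>k. real k * (a / b) ^ k)"
    by (intro convergent_imp_Bseq) (auto simp: convergent_def)
  then obtain C where C: "\<And>k. norm (real k * (a / b) ^ k) \<le> C"
    by (auto simp: Bseq_def)
  have "real k * a ^ k \<le> C * b ^ k" for k
    using C[of k] assms by (simp add: power_divide abs_mult field_simps)
  then show ?thesis by blast
qed

text \<open>The finitely many exceptional indices are absorbed by adding their ratios to the
  constant.\<close>

lemma eventually_bound_imp_bound:
  fixes a b :: "nat \<Rightarrow> real"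
  assumes ev: "eventually (\<lambda>k. \<bar>a k\<bar> \<le> C * b k) sequentially" and b: "\<And>k. 0 < b k"
  shows "\<exists>C. \<forall>k. \<bar>a k\<bar> \<le> C * b k"
proof -
  from ev obtain m where m: "\<And>k. k \<ge> m \<Longrightarrow> \<bar>a k\<bar> \<le> C * b k"
    by (auto simp: eventually_sequentially)
  define B where "B = \<bar>C\<bar> + (\<Sum>k<m. \<bar>a k\<bar> / b k)"
  have nn: "0 \<le> (\<Sum>k<m. \<bar>a k\<bar> / b k)"
    using b by (intro sum_nonneg) (simp add: less_imp_le)
  have "\<bar>a k\<bar> \<le> B * b k" for k
  proof (cases "k < m")
    case True
    have "\<bar>a k\<bar> / b k \<le> (\<Sum>k<m. \<bar>a k\<bar> / b k)"
      using True b by (intro member_le_sum) (auto simp: less_imp_le)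
    then have "\<bar>a k\<bar> / b k \<le> B" by (simp add: B_def)
    then show ?thesis using b[of k] by (simp add: field_simps)
  next
    case False
    then have "\<bar>a k\<bar> \<le> C * b k" by (intro m) simp
    also have "\<dots> \<le> B * b k"
      using nn b[of k] by (intro mult_right_mono) (auto simp: B_def)
    finally show ?thesis .
  qed
  then show ?thesis by blast
qed

section \<open>The error estimate for all exponents\<close>

theorem theorem1p2:
  fixes \<sigma> D :: "nat \<Rightarrow> real"
  assumes "\<And>k. k \<ge> 1 \<Longrightarrow> \<sigma> k > 0"
    and "\<And>k. k \<ge> 1 \<Longrightarrow> D k > 0"
    and "\<And>k. k \<ge> 1 \<Longrightarrow>
           (\<lambda>N. real (stern_moment k N)) \<sim>[at_top] (\<lambda>N. D k * \<sigma> k ^ N)"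
  shows "\<exists>C. \<forall>k\<ge>1. \<bar>\<sigma> k / golden ^ k - 1 - delta2 ^ k\<bar> \<le> C * eta ^ k"
proof -
  define g where "g = 1 / golden\<^sup>2"
  have g: "0 < g" "g \<le> 0.4"
  proof -
    have "golden\<^sup>2 = golden + 1" by (simp add: power2_eq_square golden_sq)
    then show "0 < g" "g \<le> 0.4" using golden_bounds by (simp_all add: g_def field_simps)
  qed
  have d2: "delta2 * delta2 = 0.8" by (simp add: delta2_def)
  have d: "0 < delta2" "delta2 \<le> 0.9"
  proof -
    have "delta2\<^sup>2 \<le> 0.9\<^sup>2" using d2 by (simp add: power2_eq_square)
    then show "delta2 \<le> 0.9" by (rule power2_le_imp_le) simp
  qed (rule delta2_pos)
  have dg: "delta2 * (2 * g) < eta"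
    using mult_mono[OF d(2) g(2)] g d by (simp add: eta_def)
  \<comment> \<open>The first two error terms come from the lower bound, with
    \<open>0.8 = delta2 * delta2\<close>, the last two from the upper bound. All bases lie below
    \<open>eta\<close>, so the factor \<open>k\<close> is absorbed; 0.836 is the critical
    one.\<close>
  obtain C1 where C1: "\<And>k. real k * 0.8 ^ k \<le> C1 * eta ^ k"
    using linear_times_power_bound[of "0.8" eta] by (auto simp: eta_def)
  obtain C2 where C2: "\<And>k. real k * (delta2 * g) ^ k \<le> C2 * eta ^ k"
    using linear_times_power_bound[of "delta2 * g" eta] dg mult_pos_pos[OF d(1) g(1)] by auto
  obtain C3 where C3: "\<And>k. real k * (delta2 * (2 * g)) ^ k \<le> C3 * eta ^ k"
    using linear_times_power_bound[OF _ dg] d g by auto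
  obtain C4 where C4: "\<And>k. real k * 0.836 ^ k \<le> C4 * eta ^ k"
    using linear_times_power_bound[of "0.836" eta] by (auto simp: eta_def)
  define C where "C = \<bar>C1\<bar> + \<bar>C2\<bar> + \<bar>C3\<bar> + 2 * \<bar>C4\<bar>"
  have bound: "\<bar>\<sigma> k / golden ^ k - 1 - delta2 ^ k\<bar> \<le> C * eta ^ k"
    if k: "k \<ge> 1" "0.999 ^ k + 0.95 ^ k \<le> (1 / 2 :: real)"
      "real k * delta2 ^ k + real k * g ^ k < 1" for k
  proof -
    define \<rho> where "\<rho> = \<sigma> k / golden ^ k"
    have gk: "0 < golden ^ k" using golden_pos by simp
    have g1: "g ^ k \<le> 1" "0 \<le> g ^ k" using g by (auto intro!: power_le_one)
    \<comment> \<open>The subtracted terms are the losses in Bernoulli's inequality for the powers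
      of \<open>1 / (1 + \<epsilon>)\<close> and of \<open>1 - g ^ k\<close>.\<close>
    define \<epsilon> where "\<epsilon> = delta2 ^ k * (1 - (real k * delta2 ^ k + real k * g ^ k))"
    have \<epsilon>0: "0 < \<epsilon>" using k(3) d by (simp add: \<epsilon>_def)
    have dk: "0 < delta2 ^ k" "delta2 ^ k \<le> 1" using d by (auto intro!: power_le_one)
    have nn: "0 \<le> real k * delta2 ^ k" "0 \<le> real k * g ^ k" using d g by simp_all
    have \<epsilon>d: "\<epsilon> \<le> delta2 ^ k"
      unfolding \<epsilon>_def using dk nn by (intro mult_left_le) linarith+
    have "\<epsilon> \<le> (1 / (1 + \<epsilon>)) ^ k * (delta2 * (1 - g ^ k)) ^ k"
    proof -
      have "1 - \<epsilon> \<le> 1 / (1 + \<epsilon>)" using \<epsilon>0 by (simp add: field_simps)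
      then have "(1 - \<epsilon>) ^ k \<le> (1 / (1 + \<epsilon>)) ^ k"
        using \<epsilon>d dk by (intro power_mono) simp_all
      moreover have "1 + real k * (- \<epsilon>) \<le> (1 + - \<epsilon>) ^ k"
        using \<epsilon>d dk by (intro Bernoulli_inequality) simp
      moreover have "real k * \<epsilon> \<le> real k * delta2 ^ k"
        using \<epsilon>d by (simp add: mult_left_mono)
      ultimately have 1: "1 - real k * delta2 ^ k \<le> (1 / (1 + \<epsilon>)) ^ k" by simp
      have "1 + real k * (- (g ^ k)) \<le> (1 + - (g ^ k)) ^ k"
        using g1 by (intro Bernoulli_inequality) simp
      then have 2: "1 - real k * g ^ k \<le> (1 - g ^ k) ^ k" by simp
      have "1 - (real k * delta2 ^ k + real k * g ^ k)
          \<le> (1 - real k * delta2 ^ k) * (1 - real k * g ^ k)"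
        using mult_nonneg_nonneg[OF nn] by (simp add: left_diff_distrib right_diff_distrib)
      also have "\<dots> \<le> (1 / (1 + \<epsilon>)) ^ k * (1 - g ^ k) ^ k"
        using 1 2 k(3) nn \<epsilon>0 by (intro mult_mono) simp_all
      finally have "\<epsilon> \<le> delta2 ^ k * ((1 / (1 + \<epsilon>)) ^ k * (1 - g ^ k) ^ k)"
        using dk by (subst \<epsilon>_def) (intro mult_left_mono, simp_all)
      then show ?thesis by (simp add: power_mult_distrib mult_ac)
    qed
    then have "golden ^ k * (1 + \<epsilon>) \<le> \<sigma> k"
      using assms k(1) \<epsilon>0 unfolding g_def by (intro stern_rate_ge[of _ "D k"]) simp_all
    then have lower: "1 + \<epsilon> \<le> \<rho>" using gk by (simp add: \<rho>_def field_simps)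
    have "\<epsilon> = delta2 ^ k - real k * (delta2 * delta2) ^ k - real k * (delta2 * g) ^ k"
      by (simp add: \<epsilon>_def algebra_simps power_mult_distrib)
    then have low: "\<rho> - 1 - delta2 ^ k \<ge> - (real k * 0.8 ^ k) - real k * (delta2 * g) ^ k"
      using lower unfolding d2 by linarith
    have "\<sigma> k \<le> golden ^ k * (1 + ((delta2 * (1 + g ^ k)) ^ k + 2 * k * 0.836 ^ k))"
      using assms k(1,2) unfolding g_def by (intro stern_rate_le[of _ "D k"]) simp_all
    then have "\<rho> \<le> 1 + ((delta2 * (1 + g ^ k)) ^ k + 2 * k * 0.836 ^ k)"
      using gk by (simp add: \<rho>_def field_simps)
    moreover have "(delta2 * (1 + g ^ k)) ^ k \<le> delta2 ^ k + real k * (delta2 * (2 * g)) ^ k"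
    proof -
      have "(1 + g ^ k) ^ k \<le> 1 + (2 ^ k - 1) * g ^ k"
        using g1 by (intro one_plus_power_le)
      also have "\<dots> \<le> 1 + (2 * g) ^ k"
        using g1 by (simp add: power_mult_distrib left_diff_distrib)
      finally have "(delta2 * (1 + g ^ k)) ^ k \<le> delta2 ^ k * (1 + (2 * g) ^ k)"
        unfolding power_mult_distrib[of delta2] using dk by (intro mult_left_mono) simp_all
      also have "\<dots> = delta2 ^ k + 1 * (delta2 * (2 * g)) ^ k"
        by (simp add: distrib_left power_mult_distrib)
      \<comment> \<open>The factor \<open>k\<close>, at least 1, is inserted only to match the bound
        with \<open>C3\<close>.\<close>
      also have "\<dots> \<le> delta2 ^ k + real k * (delta2 * (2 * g)) ^ k"
        using k(1) d g by (intro add_left_mono mult_right_mono) simp_all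
      finally show ?thesis .
    qed
    ultimately have up: "\<rho> - 1 - delta2 ^ k \<le> real k * (delta2 * (2 * g)) ^ k + 2 * (real k * 0.836 ^ k)"
      by simp
    have abs_le: "x \<le> \<bar>c\<bar> * eta ^ k" if "x \<le> c * eta ^ k" for x c
      by (rule order_trans[OF that mult_right_mono[OF abs_ge_self]]) (simp add: eta_def)
    note b = abs_le[OF C1[of k]] abs_le[OF C2[of k]] abs_le[OF C3[of k]] abs_le[OF C4[of k]]
    have nn': "0 \<le> \<bar>c\<bar> * eta ^ k" for c by (simp add: eta_def)
    have "C * eta ^ k = \<bar>C1\<bar> * eta ^ k + \<bar>C2\<bar> * eta ^ k + \<bar>C3\<bar> * eta ^ k + 2 * (\<bar>C4\<bar> * eta ^ k)"
      by (simp add: C_def distrib_right)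
    then show ?thesis
      using low up b nn'[of C1] nn'[of C2] nn'[of C3] nn'[of C4] unfolding \<rho>_def[symmetric] abs_le_iff
      by linarith
  qed
  have "(\<lambda>k. 0.999 ^ k + 0.95 ^ k :: real) \<longlonglongrightarrow> 0 + 0"
    by (intro tendsto_add LIMSEQ_power_zero) simp_all
  then have ev1: "eventually (\<lambda>k. 0.999 ^ k + 0.95 ^ k < (1 / 2 :: real)) sequentially"
    by (rule order_tendstoD) simp
  have "(\<lambda>k. real k * delta2 ^ k + real k * g ^ k) \<longlonglongrightarrow> 0 + 0"
    using d g by (intro tendsto_add powser_times_n_limit_0) simp_all
  then have ev2: "eventually (\<lambda>k. real k * delta2 ^ k + real k * g ^ k < 1) sequentially"
    by (rule order_tendstoD) simp
  have "eventually (\<lambda>k. \<bar>\<sigma> k / golden ^ k - 1 - delta2 ^ k\<bar> \<le> C * eta ^ k) sequentially"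
    using ev1 ev2 eventually_ge_at_top[of 1] by eventually_elim (rule bound, simp_all)
  then have "\<exists>C. \<forall>k. \<bar>\<sigma> k / golden ^ k - 1 - delta2 ^ k\<bar> \<le> C * eta ^ k"
    by (rule eventually_bound_imp_bound) (simp add: eta_def)
  then show ?thesis by blast
qed

end
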